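(* There is no completely regular code with intersection array $\{24,21,10;1,4,12\}$ in the Hamming graph $H(8,4)$.
   Context: The Hamming graph $H(n,q)$ has as vertices all words of length $n$ over an alphabet of size $q$, two words being adjacent iff they differ in exactly one position. A partition $(C_0,\dots,C_{k-1})$ of the vertex set of a graph into nonempty sets is equitable with quotient matrix $(S_{i,j})$ if every vertex of $C_i$ has exactly $S_{i,j}$ neighbors in $C_j$ for all $i,j$. For a nonempty vertex set $C$ of a graph, let $C^{(i)}$ be the set of vertices at graph distance exactly $i$ from $C$; the covering radius $\rho$ is the largest $i$ with $C^{(i)}\neq\emptyset$. The set $C$ is a completely regular code if the distance partition $(C^{(0)},\dots,C^{(\rho)})$ is equitable. Its quotient matrix $S$ is tridiagonal, and the intersection array is $\{b_0,\dots,b_{\rho-1};c_1,\dots,c_\rho\}=\{S_{0,1},S_{1,2},\dots,S_{\rho-1,\rho};S_{1,0},S_{2,1},\dots,S_{\rho,\rho-1}\}$; the diagonal entries are determined by the degree of the graph. *)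

theory Defs
  imports "HOL-Library.Extended_Nat" "HOL-Library.Disjoint_Sets"
begin

text \<open>
  A simple graph is given by its vertex set \<open>V\<close> and its edge relation \<open>E \<subseteq> V \<times> V\<close>, which is
  symmetric and irreflexive.
\<close>

definition hamming_verts :: "nat \<Rightarrow> 'a set \<Rightarrow> 'a list set" where
  "hamming_verts n A = {w. length w = n \<and> set w \<subseteq> A}"

text \<open>\<open>H(n, q)\<close> is obtained for any alphabet \<open>A\<close> with \<open>card A = q\<close>.\<close>

definition hamming_edges :: "nat \<Rightarrow> 'a set \<Rightarrow> 'a list rel" where
  "hamming_edges n A =
    {(x, y). x \<in> hamming_verts n A \<and> y \<in> hamming_verts n A \<and> card {i. i < n \<and> x ! i \<noteq> y ! i} = 1}"

text \<open>\<open>(x, y) \<in> E ^^ k\<close> means that there is a walk of length \<open>k\<close> from \<open>x\<close> to \<open>y\<close>.\<close>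

definition graph_dist :: "'v rel \<Rightarrow> 'v \<Rightarrow> 'v \<Rightarrow> enat" where
  "graph_dist E x y = (INF k \<in> {k. (x, y) \<in> E ^^ k}. enat k)"

definition dist_to_set :: "'v rel \<Rightarrow> 'v set \<Rightarrow> 'v \<Rightarrow> enat" where
  "dist_to_set E C x = (INF c \<in> C. graph_dist E x c)"

definition layer :: "'v set \<Rightarrow> 'v rel \<Rightarrow> 'v set \<Rightarrow> nat \<Rightarrow> 'v set" where
  "layer V E C i = {x \<in> V. dist_to_set E C x = enat i}"

text \<open>For finite \<open>V\<close> and nonempty \<open>C \<subseteq> V\<close> the maximum is over a finite nonempty set.\<close>

definition covering_radius :: "'v set \<Rightarrow> 'v rel \<Rightarrow> 'v set \<Rightarrow> nat" where
  "covering_radius V E C = Max {i. layer V E C i \<noteq> {}}"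

text \<open>
  The parts of a partition are \<open>P 0, \<dots>, P (k - 1)\<close>; only the entries \<open>S i j\<close> with
  \<open>i, j < k\<close> of the quotient matrix are relevant.
\<close>

definition equitable_partition ::
  "'v set \<Rightarrow> 'v rel \<Rightarrow> nat \<Rightarrow> (nat \<Rightarrow> 'v set) \<Rightarrow> (nat \<Rightarrow> nat \<Rightarrow> nat) \<Rightarrow> bool" where
  "equitable_partition V E k P S \<longleftrightarrow>
    (\<forall>i<k. P i \<noteq> {}) \<and>
    disjoint_family_on P {..<k} \<and>
    (\<Union>i<k. P i) = V \<and>
    (\<forall>i<k. \<forall>j<k. \<forall>x \<in> P i. card {y \<in> P j. (x, y) \<in> E} = S i j)"

definition completely_regular_with ::
  "'v set \<Rightarrow> 'v rel \<Rightarrow> 'v set \<Rightarrow> (nat \<Rightarrow> nat \<Rightarrow> nat) \<Rightarrow> bool" where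
  "completely_regular_with V E C S \<longleftrightarrow>
    C \<noteq> {} \<and> C \<subseteq> V \<and>
    equitable_partition V E (Suc (covering_radius V E C)) (layer V E C) S"

definition completely_regular :: "'v set \<Rightarrow> 'v rel \<Rightarrow> 'v set \<Rightarrow> bool" where
  "completely_regular V E C \<longleftrightarrow> (\<exists>S. completely_regular_with V E C S)"

text \<open>
  The intersection array \<open>{b\<^sub>0, \<dots>, b\<^sub>\<rho>\<^sub>-\<^sub>1; c\<^sub>1, \<dots>, c\<^sub>\<rho>}\<close> is represented by two lists of length \<open>\<rho>\<close>.
  As the parts are nonempty, the relevant entries of \<open>S\<close> are determined by \<open>C\<close>.
\<close>

definition has_intersection_array ::
  "'v set \<Rightarrow> 'v rel \<Rightarrow> 'v set \<Rightarrow> nat list \<Rightarrow> nat list \<Rightarrow> bool" where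
  "has_intersection_array V E C bs cs \<longleftrightarrow>
    (\<exists>S. completely_regular_with V E C S \<and>
      bs = map (\<lambda>i. S i (Suc i)) [0..<covering_radius V E C] \<and>
      cs = map (\<lambda>i. S (Suc i) i) [0..<covering_radius V E C])"

end

theory Submission
  imports Defs
begin

text \<open>
  The intersection array forces so much local structure on a code \<open>C\<close> that a parity argument on the
  codewords at distance \<open>4\<close> from one fixed codeword \<open>c\<close> gives a contradiction.

  \<^bold>\<open>Counting around a vertex.\<close> For an equitable partition of a Hamming graph and any vertex \<open>c\<close>, let
  \<open>N k j\<close> be the number of vertices of the \<open>j\<close>-th part at distance \<open>k\<close> from \<open>c\<close>. Counting the edges
  between the sphere of radius \<open>k\<close> and the \<open>j\<close>-th part in two ways yields a three-term recursion for
  the row \<open>N k\<close> (\<open>sphere_count_recursion\<close>), so all these numbers depend only on the part of \<open>c\<close>.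
  For the array at hand the diagonal of the quotient matrix follows from the degree \<open>24\<close>, and the
  recursion gives two facts:

    \<^item> Around a codeword there is no codeword at distance \<open>1\<close>, \<open>2\<close>, \<open>3\<close> or \<open>5\<close>, and every word at
      distance \<open>2\<close> lies in layer \<open>2\<close> (\<open>counts_from_P0\<close>).
    \<^item> Around a word of layer \<open>2\<close> there are exactly two codewords at distance \<open>2\<close>
      (\<open>count_from_P2\<close>).

  \<^bold>\<open>A design at a codeword.\<close> Fix \<open>c \<in> C\<close> and call the codewords at distance \<open>4\<close> from \<open>c\<close> blocks.
  The two facts say that for any two positions and any two letters differing from those of \<open>c\<close>
  there is exactly one block with these letters in these positions (\<open>unique_block\<close>).
  Let two distinct blocks agree in a position \<open>i\<close> where they differ from \<open>c\<close>, and let \<open>m\<close> be the number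
  of other positions in which both differ from \<open>c\<close>. By uniqueness they disagree in all of these, so
  their distance is \<open>6 - m\<close>; as it is not \<open>5\<close>, nor between \<open>1\<close> and \<open>3\<close>, the number \<open>m\<close> is \<open>0\<close> or \<open>2\<close>
  (\<open>blocks_meet_evenly\<close>).

  \<^bold>\<open>Parity.\<close> Consider the blocks with a given letter \<open>a \<noteq> c ! 0\<close> in position \<open>0\<close>. In each of the
  remaining \<open>7\<close> positions exactly three of them differ from \<open>c\<close>, one for each letter, so the sum of \<open>m\<close>
  over all unordered pairs of these blocks is \<open>7 \<cdot> 3 = 21\<close>. An odd number is not a sum of even ones
  (\<open>exists_odd_intersection\<close>).
\<close>

section \<open>Distances and neighbours in Hamming graphs\<close>

definition hdist :: "nat \<Rightarrow> 'a list \<Rightarrow> 'a list \<Rightarrow> nat" where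
  "hdist n x y = card {i. i < n \<and> x ! i \<noteq> y ! i}"

lemma hdist_commute: "hdist n x y = hdist n y x"
  unfolding hdist_def by (rule arg_cong[where f = card]) auto

lemma hdist_eq_0_iff:
  assumes "x \<in> hamming_verts n A" "y \<in> hamming_verts n A"
  shows "hdist n x y = 0 \<longleftrightarrow> x = y"
  using assms by (auto simp: hdist_def hamming_verts_def intro: nth_equalityI)

lemma finite_hamming_verts: "finite A \<Longrightarrow> finite (hamming_verts n A)"
  using finite_lists_length_eq[of A n] by (simp add: hamming_verts_def conj_commute)

lemma hamming_edges_iff:
  "(x, y) \<in> hamming_edges n A \<longleftrightarrow>
    x \<in> hamming_verts n A \<and> y \<in> hamming_verts n A \<and> hdist n x y = 1"
  by (simp add: hamming_edges_def hdist_def)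

lemma hamming_edges_sym: "(x, y) \<in> hamming_edges n A \<longleftrightarrow> (y, x) \<in> hamming_edges n A"
  by (auto simp: hamming_edges_iff hdist_commute)

lemma hamming_verts_nth: "x \<in> hamming_verts n A \<Longrightarrow> i < n \<Longrightarrow> x ! i \<in> A"
  by (auto simp: hamming_verts_def)

lemma hamming_verts_update:
  "x \<in> hamming_verts n A \<Longrightarrow> a \<in> A \<Longrightarrow> x[i := a] \<in> hamming_verts n A"
  by (auto simp: hamming_verts_def dest: set_update_subset_insert[THEN subsetD])

lemma hamming_neighbours:
  assumes y: "y \<in> hamming_verts n A"
  shows "bij_betw (\<lambda>(i, a). y[i := a]) (SIGMA i:{..<n}. A - {y ! i})
    {z. (z, y) \<in> hamming_edges n A}"
proof (rule bij_betw_imageI)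
  have len: "length y = n" using y by (simp add: hamming_verts_def)
  show "inj_on (\<lambda>(i, a). y[i := a]) (SIGMA i:{..<n}. A - {y ! i})"
  proof (rule inj_onI)
    fix p q
    assume p: "p \<in> (SIGMA i:{..<n}. A - {y ! i})" and q: "q \<in> (SIGMA i:{..<n}. A - {y ! i})"
      and eq: "(case p of (i, a) \<Rightarrow> y[i := a]) = (case q of (i, a) \<Rightarrow> y[i := a])"
    obtain i a j b where pq: "p = (i, a)" "q = (j, b)" by (cases p, cases q) blast
    have h: "i < n" "a \<noteq> y ! i" "j < n" "y[i := a] = y[j := b]" using p q eq pq by auto
    have "i = j"
      using h len by (metis nth_list_update_eq nth_list_update_neq)
    moreover have "a = b" using h len calculation by (metis nth_list_update_eq)
    ultimately show "p = q" using pq by simp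
  qed
  show "(\<lambda>(i, a). y[i := a]) ` (SIGMA i:{..<n}. A - {y ! i}) = {z. (z, y) \<in> hamming_edges n A}"
  proof (intro equalityI subsetI)
    fix z assume "z \<in> (\<lambda>(i, a). y[i := a]) ` (SIGMA i:{..<n}. A - {y ! i})"
    then obtain i a where h: "i < n" "a \<in> A" "a \<noteq> y ! i" and z: "z = y[i := a]" by auto
    have "{k. k < n \<and> y[i := a] ! k \<noteq> y ! k} = {i}"
      using h len by (auto simp: nth_list_update)
    then have "hdist n (y[i := a]) y = 1" by (simp add: hdist_def)
    then show "z \<in> {z. (z, y) \<in> hamming_edges n A}"
      using y h z by (simp add: hamming_edges_iff hamming_verts_update)
  next
    fix z assume "z \<in> {z. (z, y) \<in> hamming_edges n A}"
    then have z: "(z, y) \<in> hamming_edges n A" by simp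
    then obtain i where i: "{k. k < n \<and> z ! k \<noteq> y ! k} = {i}"
      by (auto simp: hamming_edges_iff hdist_def card_1_singleton_iff)
    then have "i < n" "z ! i \<noteq> y ! i" by auto
    moreover have "z ! i \<in> A" using z \<open>i < n\<close> by (auto simp: hamming_edges_iff hamming_verts_nth)
    moreover have "z = y[i := z ! i]"
    proof (rule nth_equalityI)
      show "length z = length (y[i := z ! i])"
        using z by (simp add: hamming_edges_iff hamming_verts_def)
      fix k assume "k < length z"
      then have "k < n" using z by (simp add: hamming_edges_iff hamming_verts_def)
      then show "z ! k = y[i := z ! i] ! k"
        using i len by (cases "k = i") auto
    qed
    ultimately show "z \<in> (\<lambda>(i, a). y[i := a]) ` (SIGMA i:{..<n}. A - {y ! i})"
      by (intro image_eqI[of _ _ "(i, z ! i)"]) auto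
  qed
qed

lemma hamming_degree:
  assumes "y \<in> hamming_verts n A" "finite A"
  shows "card {z. (z, y) \<in> hamming_edges n A} = n * (card A - 1)"
proof -
  have "card {z. (z, y) \<in> hamming_edges n A} = card (SIGMA i:{..<n}. A - {y ! i})"
    using bij_betw_same_card[OF hamming_neighbours[OF assms(1)]] by simp
  also have "\<dots> = (\<Sum>i<n. card (A - {y ! i}))" using assms by simp
  also have "\<dots> = n * (card A - 1)"
    using assms by (simp add: hamming_verts_nth card_Diff_singleton)
  finally show ?thesis .
qed

lemma hdist_update:
  assumes "length y = n" "i < n" "a \<noteq> y ! i"
  shows "hdist n (y[i := a]) c =
    (if y ! i = c ! i then hdist n y c + 1 else if a = c ! i then hdist n y c - 1 else hdist n y c)"
proof -
  let ?D = "{k. k < n \<and> y ! k \<noteq> c ! k}"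
  have fin: "finite ?D" by simp
  have eq: "{k. k < n \<and> y[i := a] ! k \<noteq> c ! k} = (if a = c ! i then ?D - {i} else insert i ?D)"
    using assms by (auto simp: nth_list_update)
  show ?thesis
    unfolding hdist_def eq using assms fin
    by (auto simp: card_Diff_singleton card_insert_if)
qed

text \<open>
  The neighbours of \<open>y\<close> are enumerated by the changed position and the new letter. A neighbour is
  nearer to \<open>c\<close> if a wrong letter is corrected, equally near if a wrong letter is replaced by another
  wrong one, and farther away if a correct letter is spoilt. The condition \<open>k > 0\<close> keeps the
  truncated \<open>k - 1\<close> from counting the case \<open>k = 0\<close>, \<open>y = c\<close>.
\<close>

lemma hamming_neighbours_at_distance:
  assumes y: "y \<in> hamming_verts n A" and c: "c \<in> hamming_verts n A" and fin: "finite A"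
  shows "card {z. (z, y) \<in> hamming_edges n A \<and> hdist n z c = k} =
    (k + 1) * of_bool (hdist n y c = k + 1)
    + k * (card A - 2) * of_bool (hdist n y c = k)
    + (n - (k - 1)) * (card A - 1) * of_bool (k > 0 \<and> hdist n y c = k - 1)"
proof -
  let ?Sg = "SIGMA i:{..<n}. A - {y ! i}"
  let ?D = "{i. i < n \<and> y ! i \<noteq> c ! i}"
  let ?d = "hdist n y c"
  have len: "length y = n" using y by (simp add: hamming_verts_def)
  have d: "card ?D = ?d" by (simp add: hdist_def)
  have yA: "\<And>i. i < n \<Longrightarrow> y ! i \<in> A" and cA: "\<And>i. i < n \<Longrightarrow> c ! i \<in> A"
    using y c by (simp_all add: hamming_verts_nth)
  have dpos: "?d > 0" if "i < n" "y ! i \<noteq> c ! i" for i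
    using that by (auto simp: hdist_def card_gt_0_iff)
  have "{z. (z, y) \<in> hamming_edges n A \<and> hdist n z c = k} =
      (\<lambda>(i, a). y[i := a]) ` {(i, a) \<in> ?Sg. hdist n (y[i := a]) c = k}"
    (is "?L = ?f ` ?R")
  proof -
    have "?L = {z \<in> ?f ` ?Sg. hdist n z c = k}"
      using bij_betw_imp_surj_on[OF hamming_neighbours[OF y]] by auto
    also have "\<dots> = ?f ` ?R" by (auto simp: image_iff)
    finally show ?thesis .
  qed
  moreover have "inj_on (\<lambda>(i, a). y[i := a]) {(i, a) \<in> ?Sg. hdist n (y[i := a]) c = k}"
    by (rule inj_on_subset[OF bij_betw_imp_inj_on[OF hamming_neighbours[OF y]]]) auto
  ultimately have "card {z. (z, y) \<in> hamming_edges n A \<and> hdist n z c = k} =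
      card {(i, a) \<in> ?Sg. hdist n (y[i := a]) c = k}"
    by (simp add: card_image)
  also have "\<dots> = (k + 1) * of_bool (?d = k + 1) + k * (card A - 2) * of_bool (?d = k)
    + (n - (k - 1)) * (card A - 1) * of_bool (k > 0 \<and> ?d = k - 1)"
  proof -
    consider "?d = k + 1" | "?d = k" | "k > 0" "?d = k - 1"
      | "?d \<noteq> k + 1" "?d \<noteq> k" "\<not> (k > 0 \<and> ?d = k - 1)" by blast
    then show ?thesis
    proof cases
      case 1
      have "{(i, a) \<in> ?Sg. hdist n (y[i := a]) c = k} = (\<lambda>i. (i, c ! i)) ` ?D"
        using 1 by (auto simp: hdist_update[OF len] cA split: if_splits)
      moreover have "\<not> (k > 0 \<and> ?d = k - 1)" using 1 by linarith
      ultimately show ?thesis using 1 d by (simp add: card_image inj_on_def)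
    next
      case 2
      have "{(i, a) \<in> ?Sg. hdist n (y[i := a]) c = k} = (SIGMA i:?D. A - {y ! i, c ! i})"
        using 2 dpos by (fastforce simp: hdist_update[OF len] split: if_splits)
      then have "card {(i, a) \<in> ?Sg. hdist n (y[i := a]) c = k} =
          (\<Sum>i\<in>?D. card (A - {y ! i, c ! i}))" using fin by simp
      also have "\<dots> = (\<Sum>i\<in>?D. card A - 2)"
      proof (rule sum.cong[OF refl])
        fix i assume "i \<in> ?D"
        then show "card (A - {y ! i, c ! i}) = card A - 2"
          using card_Diff_subset[of "{y ! i, c ! i}" A] yA cA by auto
      qed
      moreover have "\<not> (k > 0 \<and> ?d = k - 1)" using 2 by linarith
      ultimately show ?thesis using 2 d by simp
    next
      case 3
      have "{(i, a) \<in> ?Sg. hdist n (y[i := a]) c = k} = (SIGMA i:{..<n} - ?D. A - {y ! i})"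
        using 3 dpos by (fastforce simp: hdist_update[OF len] split: if_splits)
      then have "card {(i, a) \<in> ?Sg. hdist n (y[i := a]) c = k} =
          (\<Sum>i\<in>{..<n} - ?D. card (A - {y ! i}))" using fin by simp
      also have "\<dots> = (\<Sum>i\<in>{..<n} - ?D. card A - 1)"
        using yA by (intro sum.cong[OF refl] card_Diff_singleton) blast
      also have "\<dots> = (n - ?d) * (card A - 1)"
        using card_Diff_subset[of ?D "{..<n}"] d by auto
      moreover have "?d \<noteq> k + 1" "?d \<noteq> k" using 3 by linarith+
      ultimately show ?thesis using 3 by simp
    next
      case 4
      have "{(i, a) \<in> ?Sg. hdist n (y[i := a]) c = k} = {}"
        using 4 dpos by (fastforce simp: hdist_update[OF len] split: if_splits)
      then have "card {(i, a) \<in> ?Sg. hdist n (y[i := a]) c = k} = 0" by (simp only: card.empty)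
      then show ?thesis using 4 by simp
    qed
  qed
  finally show ?thesis .
qed

section \<open>Equitable partitions seen from a vertex\<close>

definition sphere_count :: "nat \<Rightarrow> (nat \<Rightarrow> 'a list set) \<Rightarrow> 'a list \<Rightarrow> nat \<Rightarrow> nat \<Rightarrow> nat" where
  "sphere_count n P c k j = card {y \<in> P j. hdist n y c = k}"

text \<open>
  A row of the quotient matrix sums to the degree; this supplies the diagonal entries, which an
  intersection array leaves out.
\<close>

lemma equitable_row_sum:
  assumes eq: "equitable_partition (hamming_verts n A) (hamming_edges n A) m P S"
    and fin: "finite A" and i: "i < m"
  shows "(\<Sum>j<m. S i j) = n * (card A - 1)"
proof -
  let ?E = "hamming_edges n A"
  have V: "(\<Union>i<m. P i) = hamming_verts n A" and disj: "disjoint_family_on P {..<m}"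
    using eq by (simp_all add: equitable_partition_def)
  have "P i \<noteq> {}" using eq i by (simp add: equitable_partition_def)
  then obtain x where x: "x \<in> P i" by blast
  have xV: "x \<in> hamming_verts n A" using x i V by blast
  have finP: "finite (P j)" if "j < m" for j
    using that V finite_hamming_verts[OF fin, of n] finite_subset[of "P j"] by blast
  have "(\<Sum>j<m. S i j) = (\<Sum>j<m. card {y \<in> P j. (x, y) \<in> ?E})"
    using eq i x by (simp add: equitable_partition_def)
  also have "\<dots> = card (\<Union>j<m. {y \<in> P j. (x, y) \<in> ?E})"
    using disj finP by (intro card_UN_disjoint[symmetric]) (auto simp: disjoint_family_on_def)
  also have "(\<Union>j<m. {y \<in> P j. (x, y) \<in> ?E}) = {y. (y, x) \<in> ?E}"
    using V hamming_edges_sym[of x _ n A] hamming_edges_iff[of _ x n A] by blast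
  finally show ?thesis using hamming_degree[OF xV fin] by simp
qed

text \<open>
  Both sides count the edges from the sphere of radius \<open>k\<close> around \<open>c\<close> to the part \<open>P j\<close>: the left side
  by their ends in the sphere, sorted by the parts \<open>P i\<close>, the right side by their ends in \<open>P j\<close>, which
  are at distance \<open>k + 1\<close>, \<open>k\<close> or \<open>k - 1\<close> from \<open>c\<close>.
\<close>

lemma sphere_count_recursion:
  assumes eq: "equitable_partition (hamming_verts n A) (hamming_edges n A) m P S"
    and fin: "finite A" and c: "c \<in> hamming_verts n A" and j: "j < m"
  shows "(\<Sum>i<m. sphere_count n P c k i * S i j) =
    (k + 1) * sphere_count n P c (k + 1) j
    + k * (card A - 2) * sphere_count n P c k j
    + (n - (k - 1)) * (card A - 1) * (if k = 0 then 0 else sphere_count n P c (k - 1) j)"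
proof -
  let ?E = "hamming_edges n A"
  let ?V = "hamming_verts n A"
  have V: "(\<Union>i<m. P i) = ?V" and disj: "disjoint_family_on P {..<m}"
    using eq by (simp_all add: equitable_partition_def)
  have PV: "P i \<subseteq> ?V" if "i < m" for i using that V by blast
  have finV: "finite ?V" by (rule finite_hamming_verts[OF fin])
  have finP: "finite (P i)" if "i < m" for i using PV[OF that] finV by (rule finite_subset)
  have card_of_bool: "(\<Sum>y\<in>P j. of_bool (Q y)) = card {y \<in> P j. Q y}" for Q
    using finP[OF j] by (simp add: of_bool_def sum.If_cases Int_def)
  have "(\<Sum>i<m. sphere_count n P c k i * S i j) =
      (\<Sum>i<m. \<Sum>z\<in>{z \<in> P i. hdist n z c = k}. card {y \<in> P j. (z, y) \<in> ?E})"
    using eq j by (simp add: equitable_partition_def sphere_count_def)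
  also have "\<dots> = (\<Sum>z\<in>(\<Union>i<m. {z \<in> P i. hdist n z c = k}). card {y \<in> P j. (z, y) \<in> ?E})"
    using disj finP by (intro sum.UNION_disjoint[symmetric]) (auto simp: disjoint_family_on_def)
  also have "(\<Union>i<m. {z \<in> P i. hdist n z c = k}) = {z \<in> ?V. hdist n z c = k}"
    using V by auto
  also have "(\<Sum>z\<in>{z \<in> ?V. hdist n z c = k}. card {y \<in> P j. (z, y) \<in> ?E}) =
      (\<Sum>y\<in>P j. card {z \<in> {z \<in> ?V. hdist n z c = k}. (z, y) \<in> ?E})"
    using finV finP[OF j] by (intro sum_multicount_gen) auto
  also have "\<dots> = (\<Sum>y\<in>P j. card {z. (z, y) \<in> ?E \<and> hdist n z c = k})"
    by (intro sum.cong arg_cong[where f = card]) (auto simp: hamming_edges_iff)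
  also have "\<dots> = (\<Sum>y\<in>P j. (k + 1) * of_bool (hdist n y c = k + 1)
      + k * (card A - 2) * of_bool (hdist n y c = k)
      + (n - (k - 1)) * (card A - 1) * of_bool (k > 0 \<and> hdist n y c = k - 1))"
    using PV[OF j] c fin by (intro sum.cong[OF refl] hamming_neighbours_at_distance) auto
  also have "\<dots> = (k + 1) * (\<Sum>y\<in>P j. of_bool (hdist n y c = k + 1))
      + k * (card A - 2) * (\<Sum>y\<in>P j. of_bool (hdist n y c = k))
      + (n - (k - 1)) * (card A - 1) * (\<Sum>y\<in>P j. of_bool (k > 0 \<and> hdist n y c = k - 1))"
    by (simp only: sum.distrib sum_distrib_left)
  finally show ?thesis unfolding card_of_bool sphere_count_def by (cases "k = 0") simp_all
qed

lemma sphere_count_0: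
  assumes eq: "equitable_partition (hamming_verts n A) (hamming_edges n A) m P S"
    and c: "c \<in> P i" and i: "i < m" and j: "j < m"
  shows "sphere_count n P c 0 j = of_bool (i = j)"
proof -
  have V: "(\<Union>i<m. P i) = hamming_verts n A" and disj: "disjoint_family_on P {..<m}"
    using eq by (simp_all add: equitable_partition_def)
  have "c \<in> hamming_verts n A" using V c i by blast
  moreover have "P j \<subseteq> hamming_verts n A" using V j by blast
  ultimately have "{y \<in> P j. hdist n y c = 0} = P j \<inter> {c}"
    by (auto simp: hdist_eq_0_iff)
  also have "\<dots> = (if i = j then {c} else {})"
    using disj c i j by (auto simp: disjoint_family_on_def)
  finally have "{y \<in> P j. hdist n y c = 0} = (if i = j then {c} else {})" .
  then show ?thesis by (simp add: sphere_count_def)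
qed

lemma sphere_count_eq_0_D:
  assumes eq: "equitable_partition (hamming_verts n A) (hamming_edges n A) m P S"
    and fin: "finite A" and "j < m" "sphere_count n P c k j = 0" "y \<in> P j"
  shows "hdist n y c \<noteq> k"
proof -
  have "finite (P j)"
    using eq finite_hamming_verts[OF fin, of n] finite_subset[of "P j"] \<open>j < m\<close>
    by (auto simp: equitable_partition_def)
  then show ?thesis using assms by (auto simp: sphere_count_def)
qed

section \<open>Layers and intersection arrays\<close>

lemma dist_to_set_edge:
  assumes "(x, y) \<in> E"
  shows "dist_to_set E C x \<le> dist_to_set E C y + 1"
proof -
  have "graph_dist E x c \<le> graph_dist E y c + 1" for c
  proof (cases "\<exists>k. (y, c) \<in> E ^^ k")
    case False
    then show ?thesis by (simp add: graph_dist_def top_enat_def)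
  next
    case True
    then obtain l where "enat l \<in> enat ` {k. (y, c) \<in> E ^^ k}" by blast
    then have "graph_dist E y c \<in> enat ` {k. (y, c) \<in> E ^^ k}"
      unfolding graph_dist_def by (rule wellorder_InfI)
    then obtain k where k: "(y, c) \<in> E ^^ k" "graph_dist E y c = enat k" by auto
    have "(x, c) \<in> E ^^ Suc k" using assms k(1) by (rule relpow_Suc_I2)
    then have "graph_dist E x c \<le> enat (Suc k)"
      unfolding graph_dist_def by (intro INF_lower) simp
    then show ?thesis using k by (simp add: one_enat_def)
  qed
  note step = this
  show ?thesis
  proof (cases "C = {}")
    case True
    then show ?thesis by (simp add: dist_to_set_def top_enat_def)
  next
    case False
    then obtain b where "graph_dist E y b \<in> graph_dist E y ` C" by blast
    then have "dist_to_set E C y \<in> graph_dist E y ` C"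
      unfolding dist_to_set_def by (rule wellorder_InfI)
    then obtain c where c: "c \<in> C" "dist_to_set E C y = graph_dist E y c" by auto
    have "dist_to_set E C x \<le> graph_dist E x c"
      unfolding dist_to_set_def using c by (intro INF_lower)
    then show ?thesis using step[of c] c by simp
  qed
qed

text \<open>
  With the symmetry of the edge relation, this makes the quotient matrix of a distance partition
  tridiagonal.
\<close>

lemma layer_edge:
  assumes "x \<in> layer V E C i" "y \<in> layer V E C j" "(x, y) \<in> E"
  shows "i \<le> Suc j"
  using dist_to_set_edge[OF assms(3), of C] assms(1,2) by (simp add: layer_def one_enat_def)

lemma has_intersection_arrayE:
  assumes "has_intersection_array V E C bs cs"
  obtains S where "equitable_partition V E (Suc (length bs)) (layer V E C) S"
    "\<And>i. i < length bs \<Longrightarrow> S i (Suc i) = bs ! i"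
    "\<And>i. i < length bs \<Longrightarrow> S (Suc i) i = cs ! i"
proof -
  obtain S where "completely_regular_with V E C S"
    "bs = map (\<lambda>i. S i (Suc i)) [0..<covering_radius V E C]"
    "cs = map (\<lambda>i. S (Suc i) i) [0..<covering_radius V E C]"
    using assms unfolding has_intersection_array_def by blast
  then show thesis
    by (intro that[of S]) (auto simp: completely_regular_with_def)
qed

section \<open>A parity obstruction\<close>

text \<open>
  Each \<open>j\<close> lies in the intersections of exactly \<open>3\<close> unordered pairs, so the sizes of all pairwise
  intersections add up to \<open>3 * card J\<close>, which is odd.
\<close>

lemma exists_odd_intersection:
  assumes J: "finite J" "odd (card J)" and fin: "finite B"
    and three: "\<And>j. j \<in> J \<Longrightarrow> card {u \<in> B. R u j} = 3"
  shows "\<exists>u\<in>B. \<exists>v\<in>B. u \<noteq> v \<and> odd (card {j \<in> J. R u j \<and> R v j})"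
proof (rule ccontr)
  assume no: "\<not> ?thesis"
  let ?X = "{X. X \<subseteq> B \<and> card X = 2}"
  have finX: "finite ?X" using fin by simp
  have "even (card {j \<in> J. \<forall>u\<in>X. R u j})" if X: "X \<in> ?X" for X
  proof -
    obtain u v where "X = {u, v}" "u \<noteq> v" using X by (auto simp: card_2_iff)
    then show ?thesis using no X by auto
  qed
  then have "even (\<Sum>X\<in>?X. card {j \<in> J. \<forall>u\<in>X. R u j})" by (intro dvd_sum)
  also have "(\<Sum>X\<in>?X. card {j \<in> J. \<forall>u\<in>X. R u j}) = (\<Sum>j\<in>J. card {X \<in> ?X. \<forall>u\<in>X. R u j})"
    using finX J by (intro sum_multicount_gen) auto
  also have "\<dots> = (\<Sum>j\<in>J. 3)"
  proof (rule sum.cong[OF refl])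
    fix j assume j: "j \<in> J"
    have "{X \<in> ?X. \<forall>u\<in>X. R u j} = {X. X \<subseteq> {u \<in> B. R u j} \<and> card X = 2}" by auto
    then show "card {X \<in> ?X. \<forall>u\<in>X. R u j} = 3"
      using n_subsets[of "{u \<in> B. R u j}" 2] three[OF j] fin by (simp add: numeral_eq_Suc)
  qed
  finally show False using J by simp
qed

section \<open>Local structure of the code\<close>

lemma upt_4: "[0..<4] = [0, 1, 2, 3]"
  by (simp add: numeral_eq_Suc)

text \<open>
  The quotient matrix that the intersection array determines; \<open>P 0\<close> is the code, and the rows add up
  to the degree \<open>24\<close> of \<open>H(8, 4)\<close>.
\<close>

locale putative_partition =
  fixes A :: "'a set" and P :: "nat \<Rightarrow> 'a list set" and S :: "nat \<Rightarrow> nat \<Rightarrow> nat"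
  assumes card_A: "card A = 4"
    and equitable: "equitable_partition (hamming_verts 8 A) (hamming_edges 8 A) 4 P S"
    and row0: "map (S 0) [0..<4] = [0, 24, 0, 0]"
    and row1: "map (S 1) [0..<4] = [1, 2, 21, 0]"
    and row2: "map (S 2) [0..<4] = [0, 4, 10, 10]"
    and row3: "map (S 3) [0..<4] = [0, 0, 12, 12]"
begin

lemma finite_A: "finite A"
  using card_A card.infinite by fastforce

lemma P_union: "P 0 \<union> P 1 \<union> P 2 \<union> P 3 = hamming_verts 8 A"
  using equitable by (auto simp: equitable_partition_def numeral_eq_Suc lessThan_Suc)

lemma P_verts: "y \<in> P 0 \<Longrightarrow> y \<in> hamming_verts 8 A"
  using P_union by blast

lemma S_entries:
  "S 0 0 = 0" "S 0 1 = 24" "S 0 2 = 0" "S 0 3 = 0"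
  "S 1 0 = 1" "S 1 1 = 2" "S 1 2 = 21" "S 1 3 = 0"
  "S 2 0 = 0" "S 2 1 = 4" "S 2 2 = 10" "S 2 3 = 10"
  "S 3 0 = 0" "S 3 1 = 0" "S 3 2 = 12" "S 3 3 = 12"
  using row0 row1 row2 row3 by (simp_all add: upt_4 flip: One_nat_def)

text \<open>
  The recursion written out column by column for this matrix. Here the alphabet has \<open>4\<close> letters, so a
  step within a sphere has \<open>2\<close> choices of letter and a step outwards has \<open>3\<close>, and \<open>9 - k\<close> is the number
  \<open>8 - (k - 1)\<close> of positions free for a step outwards from radius \<open>k - 1\<close>.
\<close>

lemma recursion:
  assumes c: "c \<in> hamming_verts 8 A"
  defines "N \<equiv> sphere_count 8 P c"
  shows "(k + 1) * N (k + 1) 0 + 2 * k * N k 0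
      + 3 * (9 - k) * (if k = 0 then 0 else N (k - 1) 0) = N k 1"
    and "(k + 1) * N (k + 1) 1 + 2 * k * N k 1
      + 3 * (9 - k) * (if k = 0 then 0 else N (k - 1) 1) = 24 * N k 0 + 2 * N k 1 + 4 * N k 2"
    and "(k + 1) * N (k + 1) 2 + 2 * k * N k 2
      + 3 * (9 - k) * (if k = 0 then 0 else N (k - 1) 2) = 21 * N k 1 + 10 * N k 2 + 12 * N k 3"
    and "(k + 1) * N (k + 1) 3 + 2 * k * N k 3
      + 3 * (9 - k) * (if k = 0 then 0 else N (k - 1) 3) = 10 * N k 2 + 12 * N k 3"
proof -
  have sum4: "(\<Sum>i<4. f i) = f 0 + f 1 + f 2 + f 3" for f :: "nat \<Rightarrow> nat"
    by (simp add: numeral_eq_Suc)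
  note rec = sphere_count_recursion[OF equitable finite_A c, of _ k, folded N_def,
      unfolded sum4 card_A, symmetric]
  show "(k + 1) * N (k + 1) 0 + 2 * k * N k 0
      + 3 * (9 - k) * (if k = 0 then 0 else N (k - 1) 0) = N k 1"
    using rec[of 0] by (cases "k = 0") (simp_all add: S_entries S_entries[simplified] mult_ac)
  show "(k + 1) * N (k + 1) 1 + 2 * k * N k 1
      + 3 * (9 - k) * (if k = 0 then 0 else N (k - 1) 1) = 24 * N k 0 + 2 * N k 1 + 4 * N k 2"
    using rec[of 1] by (cases "k = 0") (simp_all add: S_entries S_entries[simplified] mult_ac)
  show "(k + 1) * N (k + 1) 2 + 2 * k * N k 2
      + 3 * (9 - k) * (if k = 0 then 0 else N (k - 1) 2) = 21 * N k 1 + 10 * N k 2 + 12 * N k 3"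
    using rec[of 2] by (cases "k = 0") (simp_all add: S_entries S_entries[simplified] mult_ac)
  show "(k + 1) * N (k + 1) 3 + 2 * k * N k 3
      + 3 * (9 - k) * (if k = 0 then 0 else N (k - 1) 3) = 10 * N k 2 + 12 * N k 3"
    using rec[of 3] by (cases "k = 0") (simp_all add: S_entries S_entries[simplified] mult_ac)
qed

text \<open>
  The rows \<open>N 0, \<dots>, N 4\<close> come out of the recursion one after the other. That \<open>N 5 0\<close> vanishes
  is the cancellation \<open>5 * N 5 0 = N 4 1 - 8 * N 4 0 - 15 * N 3 0 = 336 - 8 * 42 - 0\<close>.
\<close>

lemma counts_from_P0:
  assumes c: "c \<in> P 0"
  defines "N \<equiv> sphere_count 8 P c"
  shows "N 1 0 = 0" "N 2 0 = 0" "N 2 1 = 0" "N 2 3 = 0" "N 3 0 = 0" "N 5 0 = 0"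
proof -
  note rec = recursion[OF P_verts[OF c], folded N_def]
  have 0: "N 0 0 = 1" "N 0 1 = 0" "N 0 2 = 0" "N 0 3 = 0"
    unfolding N_def using sphere_count_0[OF equitable c] by simp_all
  have 1: "N 1 0 = 0" "N 1 1 = 24" "N 1 2 = 0" "N 1 3 = 0"
    using rec[of 0] 0 by simp_all
  have 2: "N 2 0 = 0" "N 2 1 = 0" "N 2 2 = 252" "N 2 3 = 0"
    using rec[of 1, unfolded nat_1_add_1] 0 1 by simp_all
  have 3: "N 3 0 = 0" "N 3 1 = 168" "N 3 2 = 504" "N 3 3 = 840"
    using rec[of 2] 1 2 by simp_all
  have 4: "N 4 0 = 42" "N 4 1 = 336"
    using rec(1,2)[of 3] 2 3 by simp_all
  have 5: "N 5 0 = 0" using rec(1)[of 4] 3 4 by simp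
  show "N 1 0 = 0" "N 2 0 = 0" "N 2 1 = 0" "N 2 3 = 0" "N 3 0 = 0" "N 5 0 = 0"
    by (fact 1 2 3 5)+
qed

lemma count_from_P2:
  assumes w: "w \<in> P 2"
  shows "card {y \<in> P 0. hdist 8 y w = 2} = 2"
proof -
  define N where "N = sphere_count 8 P w"
  have "w \<in> hamming_verts 8 A" using w P_union by blast
  note rec = recursion[OF this, folded N_def]
  have 0: "N 0 0 = 0" "N 0 1 = 0" "N 0 2 = 1" "N 0 3 = 0"
    unfolding N_def using sphere_count_0[OF equitable w] by simp_all
  have 1: "N 1 0 = 0" "N 1 1 = 4" using rec(1,2)[of 0] 0 by simp_all
  have "N 2 0 = 2" using rec(1)[of 1, unfolded nat_1_add_1] 0 1 by simp
  then show ?thesis by (simp add: N_def sphere_count_def)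
qed

lemma code_distance:
  assumes "u \<in> P 0" "c \<in> P 0" "u \<noteq> c"
  shows "hdist 8 u c = 4 \<or> hdist 8 u c \<ge> 6"
proof -
  have "hdist 8 u c \<noteq> 0" using assms P_verts hdist_eq_0_iff by metis
  moreover have "hdist 8 u c \<noteq> 1" "hdist 8 u c \<noteq> 2" "hdist 8 u c \<noteq> 3" "hdist 8 u c \<noteq> 5"
    by (rule sphere_count_eq_0_D[OF equitable finite_A _ _ assms(1)];
        simp only: counts_from_P0[OF assms(2)] zero_less_numeral)+
  ultimately show ?thesis by linarith
qed

lemma weight_two_in_P2:
  assumes c: "c \<in> P 0" and w: "w \<in> hamming_verts 8 A" "hdist 8 w c = 2"
  shows "w \<in> P 2"
proof -
  have "w \<notin> P j" if "j = 0 \<or> j = 1 \<or> j = 3" for j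
    using sphere_count_eq_0_D[OF equitable finite_A, of j c 2 w] that w(2)
      counts_from_P0(2,3,4)[OF c] by auto
  then show ?thesis using w(1) P_union by blast
qed

text \<open>
  Let \<open>w\<close> be \<open>c\<close> with the letters \<open>a\<close>, \<open>b\<close> written into the positions \<open>i\<close>, \<open>j\<close>. It lies in
  \<open>P 2\<close>, so exactly two codewords are at distance \<open>2\<close> from it: \<open>c\<close> and one more. Since distinct codewords
  are at distance at least \<open>4\<close>, a codeword \<open>u \<noteq> c\<close> is at distance \<open>2\<close> from \<open>w\<close> precisely if \<open>w\<close> is
  halfway between \<open>c\<close> and \<open>u\<close>, which means that \<open>u\<close> is a block with the two prescribed letters.
\<close>

lemma unique_block:
  assumes c: "c \<in> P 0" and i: "i < 8" "a \<in> A" "a \<noteq> c ! i" and j: "j < 8" "b \<in> A" "b \<noteq> c ! j"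
    and ij: "i \<noteq> j"
  shows "\<exists>!u. u \<in> P 0 \<and> hdist 8 u c = 4 \<and> u ! i = a \<and> u ! j = b"
proof -
  have cV: "c \<in> hamming_verts 8 A" and len: "length c = 8"
    using P_verts[OF c] by (simp_all add: hamming_verts_def)
  define w where "w = c[i := a, j := b]"
  have wi: "w ! i = a" "w ! j = b" and wk: "\<And>k. k \<noteq> i \<Longrightarrow> k \<noteq> j \<Longrightarrow> w ! k = c ! k"
    using i j ij len by (simp_all add: w_def)
  have wV: "w \<in> hamming_verts 8 A" using cV i j by (simp add: w_def hamming_verts_update)
  have "{k. k < 8 \<and> w ! k \<noteq> c ! k} = {i, j}" using wi wk i j by auto
  then have wc: "hdist 8 w c = 2" using ij by (simp add: hdist_def)
  then have "card {y \<in> P 0. hdist 8 y w = 2} = 2"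
    by (intro count_from_P2 weight_two_in_P2[OF c wV])
  moreover have "c \<in> {y \<in> P 0. hdist 8 y w = 2}" using c wc by (simp add: hdist_commute)
  ultimately obtain u0 where u0: "{y \<in> P 0. hdist 8 y w = 2} = {c, u0}" "u0 \<noteq> c"
    unfolding card_2_iff by (metis insert_commute insertE singletonD)
  have "hdist 8 u w = 2 \<longleftrightarrow> hdist 8 u c = 4 \<and> u ! i = a \<and> u ! j = b"
    if u: "u \<in> P 0" "u \<noteq> c" for u
  proof -
    let ?D = "{k. k < 8 \<and> u ! k \<noteq> c ! k}" and ?D' = "{k. k < 8 \<and> u ! k \<noteq> w ! k}"
    have fin: "finite ?D" "finite ?D'" by simp_all
    \<comment> \<open>Only the positions \<open>i\<close> and \<open>j\<close> distinguish the deviations of \<open>u\<close> from \<open>c\<close> and from \<open>w\<close>.\<close>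
    have same: "?D - {i, j} = ?D' - {i, j}" using wk by auto
    show ?thesis
    proof
      assume "hdist 8 u w = 2"
      then have D': "card ?D' = 2" by (simp add: hdist_def)
      have "card ?D \<le> card (?D - {i, j} \<union> {i, j})" by (intro card_mono) auto
      also have "\<dots> \<le> card (?D - {i, j}) + 2"
        using card_Un_le[of "?D - {i, j}" "{i, j}"] ij by simp
      finally have le: "card ?D \<le> card (?D' - {i, j}) + 2" unfolding same .
      have ge: "card ?D \<ge> 4" using code_distance[OF u(1) c u(2)] by (auto simp: hdist_def)
      have "card (?D' - {i, j}) \<le> 2" using card_mono[of ?D' "?D' - {i, j}"] D' by auto
      with le ge have "card ?D = 4" and "card (?D' - {i, j}) = card ?D'" using D' by linarith+
      then have "?D' - {i, j} = ?D'" by (intro card_subset_eq[OF fin(2)]) auto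
      then have "i \<notin> ?D'" "j \<notin> ?D'" by blast+
      then show "hdist 8 u c = 4 \<and> u ! i = a \<and> u ! j = b"
        using wi i j \<open>card ?D = 4\<close> by (simp add: hdist_def)
    next
      assume h: "hdist 8 u c = 4 \<and> u ! i = a \<and> u ! j = b"
      then have "{i, j} \<subseteq> ?D" "?D' = ?D - {i, j}" using i j wi same by auto
      then have "card ?D' = card ?D - 2"
        using card_Diff_subset[of "{i, j}" ?D] ij by simp
      then show "hdist 8 u w = 2" using h by (simp add: hdist_def)
    qed
  qed
  note iff = this
  show ?thesis
  proof (rule ex1I[of _ u0])
    have "u0 \<in> P 0" "hdist 8 u0 w = 2" using u0 by auto
    then show "u0 \<in> P 0 \<and> hdist 8 u0 c = 4 \<and> u0 ! i = a \<and> u0 ! j = b"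
      using iff u0 by blast
    fix u assume u: "u \<in> P 0 \<and> hdist 8 u c = 4 \<and> u ! i = a \<and> u ! j = b"
    then have "u \<noteq> c" using i by auto
    then show "u = u0" using u iff u0 by blast
  qed
qed

lemma block_eqI:
  assumes c: "c \<in> P 0" and u: "u \<in> P 0" "hdist 8 u c = 4" and v: "v \<in> P 0" "hdist 8 v c = 4"
    and i: "i < 8" "u ! i = v ! i" "u ! i \<noteq> c ! i" and j: "j < 8" "u ! j = v ! j" "u ! j \<noteq> c ! j"
    and ij: "i \<noteq> j"
  shows "u = v"
proof -
  have "u ! i \<in> A" "u ! j \<in> A" using P_verts[OF u(1)] i(1) j(1) by (simp_all add: hamming_verts_nth)
  from unique_block[OF c i(1) this(1) i(3) j(1) this(2) j(3) ij]
  obtain x where x: "\<forall>y. y \<in> P 0 \<and> hdist 8 y c = 4 \<and> y ! i = u ! i \<and> y ! j = u ! j \<longrightarrow> y = x"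
    by (rule ex1E)
  have "u = x" using u by (intro x[rule_format]) simp
  moreover have "v = x" using v i(2) j(2) by (intro x[rule_format]) simp
  ultimately show ?thesis by simp
qed

text \<open>
  Two blocks that share a letter in position \<open>i\<close> agree on no other position of their supports (the
  sets of positions where they differ from \<open>c\<close>), since two common letters determine a block. So they
  differ on the union of the supports except at \<open>i\<close>. The supports have size \<open>4\<close> and meet in \<open>i\<close>
  and in a set \<open>M\<close> of other positions, so the distance is \<open>8 - (card M + 1) - 1 = 6 - card M\<close>, and the only such distances
  between distinct codewords are \<open>4\<close> and \<open>6\<close>.
\<close>

lemma blocks_meet_evenly:
  assumes c: "c \<in> P 0" and i: "i < 8" and u: "u \<in> P 0" "hdist 8 u c = 4" and v: "v \<in> P 0" "hdist 8 v c = 4"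
    and uv: "u ! i = v ! i" "u ! i \<noteq> c ! i" "u \<noteq> v"
  shows "even (card {j \<in> {..<8} - {i}. u ! j \<noteq> c ! j \<and> v ! j \<noteq> c ! j})"
proof -
  let ?U = "{k. k < 8 \<and> u ! k \<noteq> c ! k}" and ?W = "{k. k < 8 \<and> v ! k \<noteq> c ! k}"
  let ?M = "{j \<in> {..<8} - {i}. u ! j \<noteq> c ! j \<and> v ! j \<noteq> c ! j}"
  have agree: "u ! k \<noteq> v ! k" if "k < 8" "k \<noteq> i" "u ! k \<noteq> c ! k" for k
    using block_eqI[OF c u v i uv(1,2) that(1) _ that(3)] uv(3) that(2) by metis
  have "u ! k \<noteq> v ! k \<longleftrightarrow> k \<noteq> i \<and> (u ! k \<noteq> c ! k \<or> v ! k \<noteq> c ! k)" if "k < 8" for k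
    using agree[OF that] uv(1) by metis
  then have "{k. k < 8 \<and> u ! k \<noteq> v ! k} = ?U \<union> ?W - {i}" by blast
  then have "hdist 8 u v = card (?U \<union> ?W) - 1"
    using i uv by (simp add: hdist_def)
  moreover have "?U \<inter> ?W = insert i ?M" using i uv by auto
  then have "card (?U \<inter> ?W) = card ?M + 1" by simp
  moreover have "card ?U + card ?W = card (?U \<union> ?W) + card (?U \<inter> ?W)"
    by (rule card_Un_Int) simp_all
  ultimately have "hdist 8 u v + card ?M = 6" if "card (?U \<union> ?W) > 0"
    using u v that by (simp add: hdist_def)
  moreover have "card (?U \<union> ?W) > 0" using i uv by (auto simp: card_gt_0_iff)
  ultimately have "hdist 8 u v + card ?M = 6" by blast
  with code_distance[OF u(1) v(1) uv(3)] have "card ?M = 0 \<or> card ?M = 2" by linarith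
  then show ?thesis by (elim disjE) (simp_all only: dvd_refl dvd_0_right)
qed

lemma contradiction: False
proof -
  have "P 0 \<noteq> {}" using equitable by (simp add: equitable_partition_def)
  then obtain c where c: "c \<in> P 0" by blast
  have cA: "c ! j \<in> A" if "j < 8" for j using P_verts[OF c] that by (rule hamming_verts_nth)
  have "card (A - {c ! 0}) = 3" using cA card_A by (simp add: card_Diff_singleton)
  then have "A - {c ! 0} \<noteq> {}" by (metis card.empty zero_neq_numeral)
  then obtain a where a: "a \<in> A" "a \<noteq> c ! 0" by blast
  let ?B = "{u \<in> P 0. hdist 8 u c = 4 \<and> u ! 0 = a}"
  let ?J = "{..<8} - {0::nat}"
  have "finite ?B"
    using finite_subset[OF _ finite_hamming_verts[OF finite_A, of 8], of ?B] P_verts by auto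
  moreover have "card {u \<in> ?B. u ! j \<noteq> c ! j} = 3" if j: "j \<in> ?J" for j
  proof -
    \<comment> \<open>One block for each of the three letters other than \<open>c ! j\<close> in position \<open>j\<close>.\<close>
    have "bij_betw (\<lambda>u. u ! j) {u \<in> ?B. u ! j \<noteq> c ! j} (A - {c ! j})"
    proof (rule bij_betw_imageI)
      show "inj_on (\<lambda>u. u ! j) {u \<in> ?B. u ! j \<noteq> c ! j}"
      proof (rule inj_onI)
        fix u v assume h: "u \<in> {u \<in> ?B. u ! j \<noteq> c ! j}" "v \<in> {u \<in> ?B. u ! j \<noteq> c ! j}" "u ! j = v ! j"
        then show "u = v"
          using block_eqI[OF c, of u v 0 j] j a by simp
      qed
      show "(\<lambda>u. u ! j) ` {u \<in> ?B. u ! j \<noteq> c ! j} = A - {c ! j}"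
      proof (intro equalityI subsetI)
        fix b assume "b \<in> (\<lambda>u. u ! j) ` {u \<in> ?B. u ! j \<noteq> c ! j}"
        then show "b \<in> A - {c ! j}" using P_verts hamming_verts_nth[of _ 8 A j] j by auto
      next
        fix b assume "b \<in> A - {c ! j}"
        then have b: "b \<in> A" "b \<noteq> c ! j" by simp_all
        with unique_block[OF c _ a, of j b] j
        obtain u where "u \<in> P 0" "hdist 8 u c = 4" "u ! 0 = a" "u ! j = b" by auto
        then show "b \<in> (\<lambda>u. u ! j) ` {u \<in> ?B. u ! j \<noteq> c ! j}"
          using b by (intro image_eqI[of _ _ u]) auto
      qed
    qed
    then have "card {u \<in> ?B. u ! j \<noteq> c ! j} = card (A - {c ! j})" by (rule bij_betw_same_card)
    then show ?thesis using cA[of j] j card_A by (simp add: card_Diff_singleton)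
  qed
  moreover have "finite ?J" "odd (card ?J)" by simp_all
  ultimately obtain u v where u: "u \<in> ?B" and v: "v \<in> ?B" and "u \<noteq> v"
    and odd: "odd (card {j \<in> ?J. u ! j \<noteq> c ! j \<and> v ! j \<noteq> c ! j})"
    using exists_odd_intersection[of ?J ?B "\<lambda>u j. u ! j \<noteq> c ! j"] by blast
  have "even (card {j \<in> ?J. u ! j \<noteq> c ! j \<and> v ! j \<noteq> c ! j})"
    using u v a \<open>u \<noteq> v\<close> by (intro blocks_meet_evenly[OF c]) simp_all
  with odd show False by contradiction
qed

end

section \<open>From the intersection array to the partition\<close>

text \<open>
  The array gives the off-diagonal entries next to the diagonal, \<open>layer_edge\<close> the zeros beyond them,
  and the row sums the diagonal.
\<close>

lemma putative_partition_of_array: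
  assumes A: "card A = 4"
    and arr: "has_intersection_array (hamming_verts 8 A) (hamming_edges 8 A) C [24, 21, 10] [1, 4, 12]"
  shows "\<exists>S. putative_partition A (layer (hamming_verts 8 A) (hamming_edges 8 A) C) S"
proof -
  let ?V = "hamming_verts 8 A" and ?E = "hamming_edges 8 A"
  let ?P = "layer ?V ?E C"
  obtain S where "equitable_partition ?V ?E (Suc (length [24, 21, 10 :: nat])) ?P S"
    and bs: "\<And>i. i < length [24, 21, 10 :: nat] \<Longrightarrow> S i (Suc i) = [24, 21, 10] ! i"
    and cs: "\<And>i. i < length [24, 21, 10 :: nat] \<Longrightarrow> S (Suc i) i = [1, 4, 12] ! i"
    by (rule has_intersection_arrayE[OF arr]) (rule that)
  then have eq: "equitable_partition ?V ?E 4 ?P S" by (simp add: numeral_eq_Suc)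
  have b: "S 0 1 = 24" "S 1 2 = 21" "S 2 3 = 10"
    using bs[of 0] bs[of 1] bs[of 2] by (simp_all add: numeral_2_eq_2 numeral_3_eq_3)
  have c: "S 1 0 = 1" "S 2 1 = 4" "S 3 2 = 12"
    using cs[of 0] cs[of 1] cs[of 2] by (simp_all add: numeral_2_eq_2 numeral_3_eq_3)
  have fin: "finite A" using A card.infinite by fastforce
  have far: "S i j = 0" if ij: "i < 4" "j < 4" "Suc i < j \<or> Suc j < i" for i j
  proof -
    have "?P i \<noteq> {}" using eq ij by (simp add: equitable_partition_def)
    then obtain x where x: "x \<in> ?P i" by blast
    have "{y \<in> ?P j. (x, y) \<in> ?E} = {}"
      using layer_edge[OF x] layer_edge[OF _ x] hamming_edges_sym[of x] ij(3)
      by (fastforce simp: not_le)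
    then have "card {y \<in> ?P j. (x, y) \<in> ?E} = 0" by (simp only: card.empty)
    then show ?thesis using eq x ij by (simp add: equitable_partition_def)
  qed
  have row: "S i 0 + S i 1 + S i 2 + S i 3 = 24" if "i < 4" for i
    using equitable_row_sum[OF eq fin that] A by (simp add: numeral_eq_Suc)
  have z: "S 0 2 = 0" "S 0 3 = 0" "S 1 3 = 0" "S 2 0 = 0" "S 3 0 = 0" "S 3 1 = 0"
    by (simp_all add: far)
  have d: "S 0 0 = 0" "S 1 1 = 2" "S 2 2 = 10" "S 3 3 = 12"
    using row[of 0] row[of 1] row[of 2] row[of 3] b c z by simp_all
  have "putative_partition A ?P S"
    by unfold_locales (use A eq b c z d in \<open>simp_all add: upt_4\<close>)
  then show ?thesis by (intro exI[of _ S])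
qed

theorem theorem6:
  fixes A :: "'a set"
  assumes "card A = 4"
  shows "\<not> (\<exists>C. completely_regular (hamming_verts 8 A) (hamming_edges 8 A) C \<and>
                has_intersection_array (hamming_verts 8 A) (hamming_edges 8 A) C [24, 21, 10] [1, 4, 12])"
  using putative_partition_of_array[OF assms] putative_partition.contradiction by blast

end
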